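(* Let $\mathcal G=(\mathcal V,\mathcal E)$ be a weakly connected oriented graph with more than two nodes, with incidence matrix $A\in\{0,\pm1\}^{\mathcal E\times\mathcal V}$, let $b\in\mathbb R^{\mathcal E}$, let $L=A^\top A$, and let $x^\star_{\rm loc}=L^\dagger A^\top b$, which is the minimum-Euclidean-norm solution of $\min_z\|Az-b\|_2^2$. Let $\gamma\in(0,1)$ and let $\{\theta(k)\}_{k\in\mathbb Z_{\ge0}}$ be i.i.d. with uniform distribution on $\mathcal E$, i.e. $\mathbb P[\theta(k)=(i,j)]=1/|\mathcal E|$ for every $(i,j)\in\mathcal E$. Initialize $x_i(0)=0$, $\kappa_i(0)=0$, $\widetilde x_i(0)=0$ for all $i\in\mathcal V$ and, for each $k\ge0$, if $\theta(k)=(i,j)$, update $$x_i(k+1)=(1-\gamma)x_i(k)+\gamma x_j(k)+\gamma b_{(i,j)},\qquad x_j(k+1)=(1-\gamma)x_j(k)+\gamma x_i(k)-\gamma b_{(i,j)},$$ $$\kappa_h(k+1)=\kappa_h(k)+1,\qquad \widetilde x_h(k+1)=\frac{1}{\kappa_h(k+1)}\big(\kappa_h(k)\widetilde x_h(k)+x_h(k+1)\big)\qquad\text{for }h\in\{i,j\},$$ and $x_\ell(k+1)=x_\ell(k)$, $\kappa_\ell(k+1)=\kappa_\ell(k)$, $\widetilde x_\ell(k+1)=\widetilde x_\ell(k)$ for $\ell\notin\{i,j\}$. Then $\lim_{k\to\infty}\widetilde x(k)=x^\star_{\rm loc}$ almost surely.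
   Context: An oriented graph is a finite graph $\mathcal G=(\mathcal V,\mathcal E)$, $\mathcal E\subseteq\mathcal V\times\mathcal V$, with $\mathcal V$ totally ordered and $(i,j)\in\mathcal E$ only if $i<j$. It is weakly connected if the graph obtained by adding the reversal of every edge has a path connecting every pair of nodes. The incidence matrix is $A_{ei}=+1$ if $e=(i,j)$ for some $j$, $A_{ei}=-1$ if $e=(j,i)$ for some $j$, and $A_{ei}=0$ otherwise. $L^\dagger$ denotes the Moore–Penrose pseudoinverse. $\widetilde x(k)$ is the vector with entries $\widetilde x_i(k)$, $i\in\mathcal V$. *)

theory Defs
  imports "HOL-Probability.Probability"
begin

(* Nodes are the elements of a finite linearly ordered type 'v; the edge set E is a
   subset of 'v \<times> 'v. *)
definition oriented_graph :: "('v::{finite,linorder} \<times> 'v) set \<Rightarrow> bool" where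
  "oriented_graph E \<longleftrightarrow> (\<forall>(i, j) \<in> E. i < j)"

definition weakly_connected :: "('v \<times> 'v) set \<Rightarrow> bool" where
  "weakly_connected E \<longleftrightarrow> (\<forall>u v. (u, v) \<in> (E \<union> E\<inverse>)\<^sup>*)"

(* The space of real vectors indexed by E is embedded in real^('v \<times> 'v) by extension with
   zeros. Accordingly the rows of the incidence matrix outside E are zero, and matrix
   products, transposes and norms agree with those of the E-indexed objects. *)
definition edge_vec :: "('v \<times> 'v) set \<Rightarrow> ('v \<times> 'v \<Rightarrow> real) \<Rightarrow> real ^ ('v::finite \<times> 'v)" where
  "edge_vec E b = (\<chi> e. if e \<in> E then b e else 0)"

definition incidence :: "('v \<times> 'v) set \<Rightarrow> real ^ 'v ^ ('v::finite \<times> 'v)" where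
  "incidence E = (\<chi> e i. if e \<in> E \<and> (\<exists>j. e = (i, j)) then 1
                         else if e \<in> E \<and> (\<exists>j. e = (j, i)) then - 1
                         else 0)"

(* The four Penrose conditions, which determine X uniquely. *)
definition moore_penrose :: "real ^ 'n::finite ^ 'm::finite \<Rightarrow> real ^ 'm ^ 'n \<Rightarrow> bool" where
  "moore_penrose A X \<longleftrightarrow>
     A ** X ** A = A \<and> X ** A ** X = X \<and>
     transpose (A ** X) = A ** X \<and> transpose (X ** A) = X ** A"

definition pinv :: "real ^ 'n::finite ^ 'm::finite \<Rightarrow> real ^ 'm ^ 'n" where
  "pinv A = (THE X. moore_penrose A X)"

definition x_loc :: "('v \<times> 'v) set \<Rightarrow> ('v \<times> 'v \<Rightarrow> real) \<Rightarrow> real ^ 'v::finite" where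
  "x_loc E b = (let A = incidence E; L = transpose A ** A
                in pinv L *v (transpose A *v edge_vec E b))"

definition least_squares_solution ::
    "real ^ 'n::finite ^ 'm::finite \<Rightarrow> real ^ 'm \<Rightarrow> real ^ 'n \<Rightarrow> bool" where
  "least_squares_solution A b z \<longleftrightarrow> is_arg_min (\<lambda>y. (norm (A *v y - b))\<^sup>2) (\<lambda>_. True) z"

(* The processes x, \<kappa> and x-tilde along a realisation t of the random edge sequence. *)
primrec gossip :: "real \<Rightarrow> ('v \<times> 'v \<Rightarrow> real) \<Rightarrow> (nat \<Rightarrow> 'v \<times> 'v) \<Rightarrow> nat \<Rightarrow> real ^ 'v::finite" where
  "gossip \<gamma> b t 0 = 0"
| "gossip \<gamma> b t (Suc k) =
     (let x = gossip \<gamma> b t k; i = fst (t k); j = snd (t k) in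
      \<chi> h. if h = i then (1 - \<gamma>) * x $ i + \<gamma> * x $ j + \<gamma> * b (i, j)
           else if h = j then (1 - \<gamma>) * x $ j + \<gamma> * x $ i - \<gamma> * b (i, j)
           else x $ h)"

primrec updates :: "(nat \<Rightarrow> 'v \<times> 'v) \<Rightarrow> nat \<Rightarrow> 'v \<Rightarrow> nat" where
  "updates t 0 = (\<lambda>h. 0)"
| "updates t (Suc k) =
     (\<lambda>h. if h \<in> {fst (t k), snd (t k)} then updates t k h + 1 else updates t k h)"

primrec local_avg :: "real \<Rightarrow> ('v \<times> 'v \<Rightarrow> real) \<Rightarrow> (nat \<Rightarrow> 'v \<times> 'v) \<Rightarrow> nat \<Rightarrow> real ^ 'v::finite" where
  "local_avg \<gamma> b t 0 = 0"
| "local_avg \<gamma> b t (Suc k) =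
     (\<chi> h. if h \<in> {fst (t k), snd (t k)}
           then 1 / real (updates t (Suc k) h) *
                (real (updates t k h) * local_avg \<gamma> b t k $ h + gossip \<gamma> b t (Suc k) $ h)
           else local_avg \<gamma> b t k $ h)"

end

theory Submission
  imports Defs "HOL-Library.Discrete_Functions"
begin

text \<open>
  Let \<open>y(k)\<close> be the error \<open>x(k) - x_loc\<close>. Each step adds to \<open>y\<close> a multiple of \<open>a_e = edge_dir e\<close>, and
  averaged over the edges it acts as \<open>I - (\<gamma> / |E|) L\<close>, which contracts the mean-zero
  vectors because the graph is connected; this bounds the second moments of \<open>y(k)\<close>. A strong law
  for orthogonal variables with bounded second moments then lets us replace, in every time average,
  a function of the next edge by its mean over \<open>E\<close>. Applied to \<open>y(k+1) - y(k)\<close>, whose sums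
  telescope, it shows that the time average of \<open>L y(k)\<close>, hence that of \<open>y(k)\<close>, tends to 0. Applied to
  \<open>y_h(k+1)\<close> on the event that node \<open>h\<close> is updated, whose conditional mean is
  \<open>(deg h * y_h - \<gamma> (L y)_h) / |E|\<close> by the normal equations, it gives the limit of the local
  averages.
\<close>

section \<open>The graph Laplacian and its pseudoinverse\<close>

text \<open>The row of the incidence matrix at an edge, as a vector. Inner products with it are
  differences across the edge, and every gossip step moves along such a vector.\<close>

definition edge_dir :: "'v \<times> 'v \<Rightarrow> real ^ 'v::finite" where
  "edge_dir e = axis (fst e) 1 - axis (snd e) 1"

lemma inner_edge_dir: "edge_dir e \<bullet> y = y $ fst e - y $ snd e"
  by (simp add: edge_dir_def inner_diff_left inner_axis')

lemma edge_dir_nth: "edge_dir e $ h = of_bool (h = fst e) - of_bool (h = snd e)"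
  by (auto simp: edge_dir_def axis_def)

text \<open>Orientation excludes loops. At a loop the first branch of \<open>incidence\<close> would
  give an entry 1, while \<open>edge_dir\<close> vanishes there.\<close>

lemma incidence_row:
  assumes "oriented_graph E"
  shows "incidence E $ e = (if e \<in> E then edge_dir e else 0)"
  using assms by (cases e) (auto simp: incidence_def vec_eq_iff edge_dir_nth oriented_graph_def)

lemma incidence_mult_nth:
  assumes "oriented_graph E"
  shows "(incidence E *v y) $ e = (if e \<in> E then edge_dir e \<bullet> y else 0)"
  using incidence_row[OF assms, of e] by (simp add: matrix_vector_mul_component)

lemma transpose_incidence_mult:
  assumes "oriented_graph E"
  shows "transpose (incidence E) *v w = (\<Sum>e\<in>E. (w $ e) *\<^sub>R edge_dir e)"
proof -
  have "(\<Sum>e\<in>E. (w $ e) *\<^sub>R edge_dir e) = (\<Sum>e\<in>UNIV. (w $ e) *\<^sub>R incidence E $ e)"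
    by (rule sum.mono_neutral_cong_left) (auto simp: incidence_row[OF assms])
  then show ?thesis
    by (simp add: vec_eq_iff matrix_vector_mult_def transpose_def mult.commute)
qed

definition laplacian :: "('v \<times> 'v) set \<Rightarrow> real ^ 'v \<Rightarrow> real ^ 'v::finite" where
  "laplacian E y = (\<Sum>e\<in>E. (edge_dir e \<bullet> y) *\<^sub>R edge_dir e)"

lemma laplacian_eq:
  assumes "oriented_graph E"
  shows "(transpose (incidence E) ** incidence E) *v y = laplacian E y"
  using assms by (simp add: matrix_vector_mul_assoc[symmetric] transpose_incidence_mult
      incidence_mult_nth laplacian_def del: transpose_matrix_vector)

lemma inner_laplacian: "y \<bullet> laplacian E z = (\<Sum>e\<in>E. (edge_dir e \<bullet> y) * (edge_dir e \<bullet> z))"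
  by (simp add: laplacian_def inner_sum_right inner_commute mult.commute)

lemma edge_dir_inner_one [simp]: "edge_dir e \<bullet> 1 = 0" "1 \<bullet> edge_dir e = 0"
  by (simp_all add: inner_edge_dir inner_commute[of 1])

lemma bounded_linear_laplacian: "bounded_linear (laplacian E)"
  unfolding linear_conv_bounded_linear[symmetric] laplacian_def
  by (rule linearI) (simp_all add: inner_add_right scaleR_add_left sum.distrib scaleR_sum_right)

text \<open>Pairing \<open>laplacian E y\<close> with \<open>y\<close> gives the sum of the squared
  edge differences. All of them vanish, so \<open>y\<close> is constant along edges in both
  directions and hence along connecting paths.\<close>

lemma laplacian_eq_0_imp_constant:
  fixes E :: "('v::finite \<times> 'v) set"
  assumes "weakly_connected E" "laplacian E y = 0"
  shows "y $ u = y $ v"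
proof -
  have "(\<Sum>e\<in>E. (edge_dir e \<bullet> y)\<^sup>2) = y \<bullet> laplacian E y"
    by (simp add: inner_laplacian power2_eq_square)
  then have 0: "edge_dir e \<bullet> y = 0" if "e \<in> E" for e
    using assms that by (simp add: sum_nonneg_eq_0_iff)
  have "(u, v) \<in> (E \<union> E\<inverse>)\<^sup>*" using assms by (simp add: weakly_connected_def)
  then show ?thesis
    by (induction rule: rtrancl_induct) (use 0 in \<open>force simp: inner_edge_dir\<close>)+
qed

lemma laplacian_injective_on_mean_zero:
  fixes E :: "('v::finite \<times> 'v) set"
  assumes "weakly_connected E" "laplacian E y = 0" "1 \<bullet> y = 0"
  shows "y = 0"
proof -
  \<comment> \<open>Since \<open>y\<close> is constant, its value at the arbitrary node
    \<open>undefined\<close> can replace one factor; the other factor then sums to 0.\<close>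
  have "y \<bullet> y = (\<Sum>i\<in>UNIV. y $ undefined * y $ i)"
    unfolding inner_vec_def inner_real_def
    by (intro sum.cong refl arg_cong2[where f = times] laplacian_eq_0_imp_constant[OF assms(1,2)])
  also have "\<dots> = 0" using assms(3) by (simp add: inner_vec_def sum_distrib_left[symmetric])
  finally show ?thesis by simp
qed

text \<open>A linear map that is injective on a closed subspace of a finite-dimensional space is
  bounded below there. This is applied to the map \<open>?T\<close> of edge differences on the
  mean-zero vectors and yields a Poincare inequality.\<close>

lemma dirichlet_coercive:
  fixes E :: "('v::finite \<times> 'v) set"
  assumes "weakly_connected E"
  obtains c where "0 < c" "\<And>y. 1 \<bullet> y = 0 \<Longrightarrow> c * (norm y)\<^sup>2 \<le> (\<Sum>e\<in>E. (edge_dir e \<bullet> y)\<^sup>2)"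
proof -
  let ?T = "\<lambda>y. (\<chi> e. if e \<in> E then edge_dir e \<bullet> y else 0) :: real ^ ('v \<times> 'v)"
  have sq: "(norm (?T y))\<^sup>2 = (\<Sum>e\<in>E. (edge_dir e \<bullet> y)\<^sup>2)" for y
  proof -
    have "(norm (?T y))\<^sup>2 = (\<Sum>e\<in>UNIV. (if e \<in> E then edge_dir e \<bullet> y else 0)\<^sup>2)"
      unfolding power2_norm_eq_inner inner_vec_def by (simp add: power2_eq_square)
    also have "\<dots> = (\<Sum>e\<in>E. (edge_dir e \<bullet> y)\<^sup>2)"
      by (rule sum.mono_neutral_cong_right) auto
    finally show ?thesis .
  qed
  have bl: "bounded_linear ?T"
    unfolding linear_conv_bounded_linear[symmetric]
    by (rule linearI) (simp_all add: vec_eq_iff inner_add_right)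
  have "\<exists>c>0. \<forall>y\<in>{y. 1 \<bullet> y = 0}. norm (?T y) \<ge> c * norm y"
  proof (rule injective_imp_isometric[OF closed_hyperplane subspace_hyperplane bl], safe)
    fix y :: "real ^ 'v" assume y: "1 \<bullet> y = 0" "?T y = 0"
    then have "laplacian E y = 0"
      by (auto simp: laplacian_def vec_eq_iff intro!: sum.neutral split: if_splits)
    then show "y = 0" using laplacian_injective_on_mean_zero[OF assms] y(1) by blast
  qed
  then obtain d where d: "d > 0" "\<And>y. 1 \<bullet> y = 0 \<Longrightarrow> norm (?T y) \<ge> d * norm y" by auto
  show thesis
  proof (rule that[of "d\<^sup>2"])
    fix y :: "real ^ 'v" assume "1 \<bullet> y = 0"
    then have "(d * norm y)\<^sup>2 \<le> (norm (?T y))\<^sup>2"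
      using d by (intro power_mono) auto
    then show "d\<^sup>2 * (norm y)\<^sup>2 \<le> (\<Sum>e\<in>E. (edge_dir e \<bullet> y)\<^sup>2)"
      by (simp add: sq power_mult_distrib)
  qed (use d in simp)
qed

text \<open>The Dirichlet form is \<open>y \<bullet> laplacian E y\<close>, so Cauchy-Schwarz turns
  its coercivity into this bound after one factor \<open>norm y\<close> is cancelled.\<close>

lemma laplacian_coercive:
  fixes E :: "('v::finite \<times> 'v) set"
  assumes "weakly_connected E"
  obtains c where "0 < c" "\<And>y. 1 \<bullet> y = 0 \<Longrightarrow> c * norm y \<le> norm (laplacian E y)"
proof -
  obtain c where c: "0 < c"
    "\<And>y. 1 \<bullet> y = 0 \<Longrightarrow> c * (norm y)\<^sup>2 \<le> (\<Sum>e\<in>E. (edge_dir e \<bullet> y)\<^sup>2)"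
    using dirichlet_coercive[OF assms] by blast
  show thesis
  proof (rule that[OF c(1)])
    fix y :: "real ^ 'v" assume "1 \<bullet> y = 0"
    then have "c * (norm y)\<^sup>2 \<le> y \<bullet> laplacian E y"
      using c(2) by (simp add: inner_laplacian power2_eq_square)
    also have "\<dots> \<le> norm y * norm (laplacian E y)" by (rule norm_cauchy_schwarz)
    finally have "norm y * (c * norm y) \<le> norm y * norm (laplacian E y)"
      by (simp add: power2_eq_square mult_ac)
    then show "c * norm y \<le> norm (laplacian E y)"
      by (cases "y = 0") (simp_all add: mult_le_cancel_left)
  qed
qed

section \<open>The pseudoinverse of the Laplacian and minimum-norm least squares\<close>

text \<open>The symmetry of \<open>A ** X\<close> and \<open>A ** Y\<close> lets transposition swap
  them in the product \<open>A ** Y ** (A ** X)\<close>, which collapses to one or the other;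
  likewise for \<open>X ** A\<close> and \<open>Y ** A\<close>. Then X = XAX = XAY = YAY =
  Y.\<close>

lemma moore_penrose_unique:
  assumes "moore_penrose A X" "moore_penrose A Y"
  shows "X = Y"
proof -
  note mp = assms[unfolded moore_penrose_def]
  have 1: "A ** X = A ** Y"
  proof -
    have "A ** X = transpose (A ** Y ** (A ** X))"
      using mp by (metis matrix_mul_assoc)
    also have "\<dots> = A ** X ** (A ** Y)"
      using mp by (metis matrix_transpose_mul)
    also have "\<dots> = A ** Y" using mp by (metis matrix_mul_assoc)
    finally show ?thesis .
  qed
  have 2: "X ** A = Y ** A"
  proof -
    have "X ** A = transpose (X ** A ** (Y ** A))"
      using mp by (metis matrix_mul_assoc)
    also have "\<dots> = Y ** A ** (X ** A)"
      using mp by (metis matrix_transpose_mul)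
    also have "\<dots> = Y ** A" using mp by (metis matrix_mul_assoc)
    finally show ?thesis .
  qed
  show ?thesis using mp 1 2 by (metis matrix_mul_assoc)
qed

lemma pinv_eqI: "moore_penrose A X \<Longrightarrow> pinv A = X"
  unfolding pinv_def using moore_penrose_unique by blast

lemma matrix_add_rdistrib: "(B + C) ** A = B ** A + C ** (A :: real ^ 'n::finite ^ 'm::finite)"
  by (simp add: vec_eq_iff matrix_matrix_mult_def sum.distrib distrib_right)

lemma matrix_diff_rdistrib: "(B - C) ** A = B ** A - C ** (A :: real ^ 'n::finite ^ 'm::finite)"
  by (simp add: vec_eq_iff matrix_matrix_mult_def sum_subtractf left_diff_distrib)

lemma matrix_diff_ldistrib: "A ** (B - C) = A ** B - A ** (C :: real ^ 'n::finite ^ 'm::finite)"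
  by (simp add: vec_eq_iff matrix_matrix_mult_def sum_subtractf right_diff_distrib)

text \<open>The orthogonal projection onto the constant vectors, which form the kernel of the
  Laplacian of a connected graph.\<close>

definition avg_matrix :: "real ^ 'n::finite ^ 'n" where
  "avg_matrix = (\<chi> i j. 1 / real CARD('n))"

lemma avg_matrix_mult: "avg_matrix *v y = ((1 \<bullet> y) / real CARD('n)) *\<^sub>R (1 :: real ^ 'n::finite)"
  by (simp add: avg_matrix_def vec_eq_iff matrix_vector_mult_def inner_vec_def sum_divide_distrib)

lemma avg_matrix_idem: "avg_matrix ** avg_matrix = (avg_matrix :: real ^ 'n::finite ^ 'n)"
  unfolding matrix_eq
  by (simp add: matrix_vector_mul_assoc[symmetric] avg_matrix_mult inner_vec_def)

lemma inner_one_laplacian [simp]: "1 \<bullet> laplacian E y = 0"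
  by (simp add: inner_laplacian)

lemma laplacian_scaleR_one: "laplacian E (c *\<^sub>R 1) = 0"
  by (simp add: laplacian_def)

text \<open>Write J for \<open>avg_matrix\<close>. Adding J repairs the kernel of L, so L + J has an
  inverse B. Both B and L + J fix J, and therefore X = B - J satisfies LX = XL = I - J and JX = 0;
  the Penrose conditions follow because I - J is symmetric.\<close>

lemma moore_penrose_laplacian:
  fixes E :: "('v::{finite,linorder} \<times> 'v) set"
  assumes "oriented_graph E" "weakly_connected E"
  defines "L \<equiv> transpose (incidence E) ** incidence E"
  obtains X where "moore_penrose L X" "L ** X = mat 1 - avg_matrix" "avg_matrix ** X = 0"
proof -
  let ?J = "avg_matrix :: ((real, 'v) vec, 'v) vec"
  have Lv: "L *v y = laplacian E y" for y
    unfolding L_def by (rule laplacian_eq[OF assms(1)])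
  have LJ: "L ** ?J = 0" and JL: "?J ** L = 0"
    unfolding matrix_eq
    by (simp_all only: matrix_vector_mul_assoc[symmetric] Lv avg_matrix_mult laplacian_scaleR_one
        inner_one_laplacian) simp_all
  have "\<exists>B. B ** (L + ?J) = mat 1"
    unfolding matrix_left_invertible_ker
  proof safe
    fix y assume y: "(L + ?J) *v y = 0"
    then have *: "laplacian E y + ?J *v y = 0"
      by (simp only: matrix_vector_mult_add_rdistrib Lv)
    \<comment> \<open>Pairing with 1 kills the Laplacian part, so a kernel vector has mean zero;
      then \<open>?J *v y\<close> vanishes and \<open>y\<close> lies in the kernel of the Laplacian
      alone.\<close>
    have "1 \<bullet> (laplacian E y + ?J *v y) = 1 \<bullet> y"
      by (simp add: inner_add_right avg_matrix_mult) (simp add: inner_vec_def)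
    with * have "1 \<bullet> y = 0" by simp
    with * have "laplacian E y = 0" by (simp add: avg_matrix_mult)
    then show "y = 0"
      using laplacian_injective_on_mean_zero assms(2) \<open>1 \<bullet> y = 0\<close> by blast
  qed
  then obtain B where BL: "B ** (L + ?J) = mat 1" by blast
  then have LB: "(L + ?J) ** B = mat 1" by (simp add: matrix_left_right_inverse)
  have "(L + ?J) ** ?J = ?J" "?J ** (L + ?J) = ?J"
    by (simp_all add: matrix_add_rdistrib matrix_add_ldistrib LJ JL avg_matrix_idem)
  then have BJ: "B ** ?J = ?J" and JB: "?J ** B = ?J"
    using BL LB by (metis matrix_mul_assoc matrix_mul_lid, metis matrix_mul_assoc matrix_mul_rid)
  define X where "X = B - ?J"
  have LX: "L ** X = mat 1 - ?J"
    using LB by (simp add: X_def matrix_diff_ldistrib LJ matrix_add_rdistrib JB algebra_simps)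
  have XL: "X ** L = mat 1 - ?J"
    using BL by (simp add: X_def matrix_diff_rdistrib JL matrix_add_ldistrib BJ algebra_simps)
  have JX: "?J ** X = 0"
    by (simp add: X_def matrix_diff_ldistrib JB avg_matrix_idem)
  have "moore_penrose L X"
    unfolding moore_penrose_def LX XL
    by (simp add: matrix_diff_rdistrib JL JX) (simp add: transpose_def vec_eq_iff mat_def avg_matrix_def)
  then show thesis using that LX JX by blast
qed

text \<open>The second claim is the normal equations. The projection I - J in LX = I - J fixes the
  right-hand side, a combination of edge directions and thus of mean zero; JX = 0 gives the first
  claim.\<close>

lemma x_loc_properties:
  fixes E :: "('v::{finite,linorder} \<times> 'v) set"
  assumes "oriented_graph E" "weakly_connected E"
  shows "1 \<bullet> x_loc E b = 0"
    and "(\<Sum>e\<in>E. (b e - edge_dir e \<bullet> x_loc E b) *\<^sub>R edge_dir e) = 0"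
proof -
  let ?A = "incidence E"
  obtain X where X: "moore_penrose (transpose ?A ** ?A) X"
      "transpose ?A ** ?A ** X = mat 1 - avg_matrix" "avg_matrix ** X = 0"
    using moore_penrose_laplacian[OF assms] by blast
  define c where "c = (\<Sum>e\<in>E. b e *\<^sub>R edge_dir e)"
  have c: "transpose ?A *v edge_vec E b = c"
    unfolding transpose_incidence_mult[OF assms(1)] c_def by (rule sum.cong) (auto simp: edge_vec_def)
  have x: "x_loc E b = X *v c"
    using c pinv_eqI[OF X(1)] by (simp add: x_loc_def Let_def)
  have "avg_matrix *v x_loc E b = 0"
    by (simp add: x matrix_vector_mul_assoc X)
  then show "1 \<bullet> x_loc E b = 0"
    by (simp add: avg_matrix_mult)
  have "laplacian E (x_loc E b) = (mat 1 - avg_matrix) *v c"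
    by (simp only: laplacian_eq[OF assms(1), symmetric] x matrix_vector_mul_assoc X)
  also have "\<dots> = c"
    by (simp add: matrix_vector_mult_diff_rdistrib avg_matrix_mult c_def inner_sum_right)
  finally show "(\<Sum>e\<in>E. (b e - edge_dir e \<bullet> x_loc E b) *\<^sub>R edge_dir e) = 0"
    by (simp add: laplacian_def c_def algebra_simps sum_subtractf)
qed

text \<open>By the normal equations the residual at \<open>x\<close> is orthogonal to the range of
  \<open>A\<close>, so Pythagoras splits off \<open>norm (A *v (y - x))\<close> as the exact excess
  cost.\<close>

lemma least_squares_solution_iff:
  assumes "transpose A *v (A *v x - w) = 0"
  shows "least_squares_solution A w z \<longleftrightarrow> A *v (z - x) = 0"
proof -
  have *: "(norm (A *v y - w))\<^sup>2 = (norm (A *v x - w))\<^sup>2 + (norm (A *v (y - x)))\<^sup>2" for y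
  proof -
    have "(A *v (y - x)) \<bullet> (A *v x - w) = 0"
      using assms by (metis dot_lmul_matrix inner_zero_right inner_commute transpose_matrix_vector)
    moreover have "A *v y - w = A *v (y - x) + (A *v x - w)"
      by (simp add: matrix_vector_mult_diff_distrib)
    ultimately show ?thesis
      by (simp only: power2_norm_eq_inner inner_add_left inner_add_right inner_commute)
  qed
  show ?thesis
  proof
    assume "least_squares_solution A w z"
    then have "\<not> (norm (A *v x - w))\<^sup>2 < (norm (A *v z - w))\<^sup>2"
      by (simp add: least_squares_solution_def is_arg_min_def)
    then show "A *v (z - x) = 0" using *[of z] by (simp add: not_less)
  next
    assume "A *v (z - x) = 0"
    then have "(norm (A *v z - w))\<^sup>2 \<le> (norm (A *v y - w))\<^sup>2" for y
      using *[of z] *[of y] by simp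
    then show "least_squares_solution A w z"
      by (simp add: least_squares_solution_def is_arg_min_def not_less)
  qed
qed

text \<open>A least-squares solution differs from \<open>x_loc\<close> by a kernel vector of the
  Laplacian, that is by a constant. Constants are orthogonal to the mean-zero vector
  \<open>x_loc\<close>, so Pythagoras shows that any such shift increases the norm.\<close>

lemma x_loc_min_norm:
  fixes E :: "('v::{finite,linorder} \<times> 'v) set"
  assumes "oriented_graph E" "weakly_connected E"
  shows "is_arg_min norm (least_squares_solution (incidence E) (edge_vec E b)) z
           \<longleftrightarrow> z = x_loc E b"
proof -
  let ?A = "incidence E" and ?x = "x_loc E b"
  note x = x_loc_properties[OF assms, of b]
  have "transpose ?A *v (?A *v ?x - edge_vec E b) = - (\<Sum>e\<in>E. (b e - edge_dir e \<bullet> ?x) *\<^sub>R edge_dir e)"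
    unfolding transpose_incidence_mult[OF assms(1)] sum_negf[symmetric]
    by (rule sum.cong) (auto simp: edge_vec_def incidence_mult_nth[OF assms(1)] algebra_simps)
  then have "transpose ?A *v (?A *v ?x - edge_vec E b) = 0" using x by simp
  note ls = least_squares_solution_iff[OF this]
  have *: "(norm y)\<^sup>2 = (norm ?x)\<^sup>2 + (norm (y - ?x))\<^sup>2"
    if "least_squares_solution ?A (edge_vec E b) y" for y
  proof -
    let ?d = "y - ?x"
    have "laplacian E ?d = 0"
      using that unfolding ls laplacian_eq[OF assms(1), symmetric] matrix_vector_mul_assoc[symmetric]
      by simp
    then have "?d $ i = ?d $ j" for i j
      using laplacian_eq_0_imp_constant assms(2) by blast
    then have "?x \<bullet> ?d = (\<Sum>i\<in>UNIV. ?x $ i * ?d $ undefined)"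
      unfolding inner_vec_def inner_real_def by (intro sum.cong refl arg_cong2[where f = times])
    also have "\<dots> = 0" using x(1) by (simp add: inner_vec_def sum_distrib_right[symmetric])
    finally have "?x \<bullet> ?d = 0" .
    moreover have "y = ?x + ?d" by simp
    ultimately show ?thesis
      by (metis add.commute add_0 norm_add_Pythagorean orthogonal_def)
  qed
  have x_ls: "least_squares_solution ?A (edge_vec E b) ?x" by (simp add: ls)
  show ?thesis
  proof
    assume "is_arg_min norm (least_squares_solution ?A (edge_vec E b)) z"
    then have z: "least_squares_solution ?A (edge_vec E b) z" "norm z \<le> norm ?x"
      using x_ls by (auto simp: is_arg_min_def not_less)
    have "(norm z)\<^sup>2 \<le> (norm ?x)\<^sup>2" using z(2) by (simp add: power_mono)
    then show "z = ?x" using *[OF z(1)] by simp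
  next
    assume "z = ?x"
    moreover have "norm ?x \<le> norm y" if "least_squares_solution ?A (edge_vec E b) y" for y
      by (rule power2_le_imp_le) (simp_all add: *[OF that])
    ultimately show "is_arg_min norm (least_squares_solution ?A (edge_vec E b)) z"
      using x_ls by (auto simp: is_arg_min_def not_less)
  qed
qed

section \<open>Strong laws from second moments\<close>

text \<open>By monotone convergence the sum of the squares has finite expectation, so it is finite
  almost surely and its terms tend to 0.\<close>

lemma (in prob_space) AE_tendsto_0_if_second_moments_summable:
  fixes X :: "nat \<Rightarrow> 'a \<Rightarrow> real"
  assumes int: "\<And>n. integrable M (\<lambda>\<omega>. (X n \<omega>)\<^sup>2)"
    and summable: "summable (\<lambda>n. expectation (\<lambda>\<omega>. (X n \<omega>)\<^sup>2))"
  shows "AE \<omega> in M. (\<lambda>n. X n \<omega>) \<longlonglongrightarrow> 0"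
proof -
  have meas: "(\<lambda>\<omega>. ennreal ((X n \<omega>)\<^sup>2)) \<in> borel_measurable M" for n
    using borel_measurable_integrable[OF int] by simp
  have "(\<integral>\<^sup>+\<omega>. (\<Sum>n. ennreal ((X n \<omega>)\<^sup>2)) \<partial>M) = (\<Sum>n. \<integral>\<^sup>+\<omega>. ennreal ((X n \<omega>)\<^sup>2) \<partial>M)"
    by (rule nn_integral_suminf[OF meas])
  also have "\<dots> = (\<Sum>n. ennreal (expectation (\<lambda>\<omega>. (X n \<omega>)\<^sup>2)))"
    by (simp add: nn_integral_eq_integral int)
  also have "\<dots> = ennreal (\<Sum>n. expectation (\<lambda>\<omega>. (X n \<omega>)\<^sup>2))"
    by (rule suminf_ennreal2) (simp_all add: summable)
  finally have "(\<integral>\<^sup>+\<omega>. (\<Sum>n. ennreal ((X n \<omega>)\<^sup>2)) \<partial>M) \<noteq> \<infinity>" by simp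
  then have "AE \<omega> in M. (\<Sum>n. ennreal ((X n \<omega>)\<^sup>2)) \<noteq> \<infinity>"
    by (intro nn_integral_PInf_AE borel_measurable_suminf_order meas)
  then show ?thesis
  proof eventually_elim
    case (elim \<omega>)
    then have "summable (\<lambda>n. (X n \<omega>)\<^sup>2)" by (intro summable_suminf_not_top) simp_all
    then have "(\<lambda>n. (X n \<omega>)\<^sup>2) \<longlonglongrightarrow> 0" by (rule summable_LIMSEQ_zero)
    then have "(\<lambda>n. sqrt ((X n \<omega>)\<^sup>2)) \<longlonglongrightarrow> sqrt 0" by (rule tendsto_real_sqrt)
    then show ?case by (simp add: tendsto_rabs_zero_iff)
  qed
qed

lemma (in prob_space) AE_tendsto_0_if_second_moments_quadratic:
  fixes X :: "nat \<Rightarrow> 'a \<Rightarrow> real"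
  assumes int: "\<And>n. integrable M (\<lambda>\<omega>. (X n \<omega>)\<^sup>2)"
    and bound: "\<And>n. n > 0 \<Longrightarrow> expectation (\<lambda>\<omega>. (X n \<omega>)\<^sup>2) \<le> C / (real n)\<^sup>2"
  shows "AE \<omega> in M. (\<lambda>n. X n \<omega>) \<longlonglongrightarrow> 0"
proof (rule AE_tendsto_0_if_second_moments_summable[OF int])
  have "summable (\<lambda>n. C * (1 / (real n)\<^sup>2))"
    by (intro summable_mult) (use inverse_power_summable[of 2] in \<open>simp add: field_simps\<close>)
  then show "summable (\<lambda>n. expectation (\<lambda>\<omega>. (X n \<omega>)\<^sup>2))"
    by (rule summable_comparison_test_ev[rotated])
       (auto intro!: eventually_mono[OF eventually_gt_at_top[of 0]] bound)
qed

lemma floor_sqrt_bounds: "(floor_sqrt n)\<^sup>2 \<le> n" "n < (Suc (floor_sqrt n))\<^sup>2"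
  using Suc_floor_sqrt_power2_gt[of n] floor_sqrt_power2_le[of n] by simp_all

text \<open>Subsequence method. Orthogonality makes the second moment of the n-th partial sum at
  most n C, which is enough for convergence along the squares; the sums \<open>T\<close> of absolute
  values control the fluctuation between consecutive squares.\<close>

lemma (in prob_space) strong_law_orthogonal:
  fixes D :: "nat \<Rightarrow> 'a \<Rightarrow> real"
  assumes int: "\<And>j k. integrable M (\<lambda>\<omega>. D j \<omega> * D k \<omega>)"
    and meas [measurable]: "\<And>k. D k \<in> borel_measurable M"
    and orth: "\<And>j k. j < k \<Longrightarrow> expectation (\<lambda>\<omega>. D j \<omega> * D k \<omega>) = 0"
    and bound: "\<And>k. expectation (\<lambda>\<omega>. (D k \<omega>)\<^sup>2) \<le> C"
  shows "AE \<omega> in M. (\<lambda>n. (\<Sum>k<n. D k \<omega>) / real n) \<longlonglongrightarrow> 0"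
proof -
  have C: "0 \<le> C" using bound[of 0] by (rule order_trans[rotated]) simp
  have orth': "expectation (\<lambda>\<omega>. D j \<omega> * D k \<omega>) = 0" if "j \<noteq> k" for j k
    using orth[of j k] orth[of k j] that by (cases "j < k") (simp_all add: mult.commute)
  define S where "S = (\<lambda>n \<omega>. \<Sum>k<n. D k \<omega>)"
  define T where "T = (\<lambda>n \<omega>. \<Sum>k\<in>{n\<^sup>2..<(Suc n)\<^sup>2}. \<bar>D k \<omega>\<bar>)"
  have S_sq: "(S n \<omega>)\<^sup>2 = (\<Sum>j<n. \<Sum>k<n. D j \<omega> * D k \<omega>)" for n \<omega>
    by (simp add: S_def power2_eq_square sum_product)
  have S_int: "integrable M (\<lambda>\<omega>. (S n \<omega>)\<^sup>2)" for n
    unfolding S_sq by (intro Bochner_Integration.integrable_sum int)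
  have S_bound: "expectation (\<lambda>\<omega>. (S n \<omega>)\<^sup>2) \<le> real n * C" for n
  proof -
    have "expectation (\<lambda>\<omega>. (S n \<omega>)\<^sup>2) = (\<Sum>j<n. \<Sum>k<n. expectation (\<lambda>\<omega>. D j \<omega> * D k \<omega>))"
      unfolding S_sq by (simp add: int)
    also have "\<dots> = (\<Sum>j<n. \<Sum>k<n. if j = k then expectation (\<lambda>\<omega>. (D k \<omega>)\<^sup>2) else 0)"
      by (intro sum.cong refl) (auto simp: orth' power2_eq_square)
    also have "\<dots> \<le> real n * C"
      using sum_bounded_above[of "{..<n}" "\<lambda>k. expectation (\<lambda>\<omega>. (D k \<omega>)\<^sup>2)" C] bound by simp
    finally show ?thesis .
  qed
  have sq_int: "integrable M (\<lambda>\<omega>. (D k \<omega>)\<^sup>2)" for k using int[of k k] by (simp add: power2_eq_square)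
  \<comment> \<open>Cauchy-Schwarz against the constant 1 over the 2 n + 1 indices of the
    block.\<close>
  have T_le: "(T n \<omega>)\<^sup>2 \<le> real (2 * n + 1) * (\<Sum>k\<in>{n\<^sup>2..<(Suc n)\<^sup>2}. (D k \<omega>)\<^sup>2)" for n \<omega>
  proof -
    have "card {n\<^sup>2..<(Suc n)\<^sup>2} = 2 * n + 1" by (simp add: power2_eq_square)
    then show ?thesis
      using Cauchy_Schwarz_ineq_sum[of "\<lambda>_. 1" "\<lambda>k. \<bar>D k \<omega>\<bar>" "{n\<^sup>2..<(Suc n)\<^sup>2}"]
      by (simp add: T_def)
  qed
  have T_int: "integrable M (\<lambda>\<omega>. (T n \<omega>)\<^sup>2)" for n
  proof (rule Bochner_Integration.integrable_bound)
    show "integrable M (\<lambda>\<omega>. real (2 * n + 1) * (\<Sum>k\<in>{n\<^sup>2..<(Suc n)\<^sup>2}. (D k \<omega>)\<^sup>2))"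
      by (intro integrable_mult_right Bochner_Integration.integrable_sum sq_int)
    show "(\<lambda>\<omega>. (T n \<omega>)\<^sup>2) \<in> borel_measurable M" unfolding T_def by measurable
    show "AE \<omega> in M. norm ((T n \<omega>)\<^sup>2) \<le> norm (real (2 * n + 1) * (\<Sum>k\<in>{n\<^sup>2..<(Suc n)\<^sup>2}. (D k \<omega>)\<^sup>2))"
      using T_le by (auto intro!: AE_I2 order_trans[OF _ abs_ge_self])
  qed
  have T_bound: "expectation (\<lambda>\<omega>. (T n \<omega>)\<^sup>2) \<le> (real (2 * n + 1))\<^sup>2 * C" for n
  proof -
    have "expectation (\<lambda>\<omega>. (T n \<omega>)\<^sup>2)
        \<le> expectation (\<lambda>\<omega>. real (2 * n + 1) * (\<Sum>k\<in>{n\<^sup>2..<(Suc n)\<^sup>2}. (D k \<omega>)\<^sup>2))"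
      by (intro integral_mono T_int T_le integrable_mult_right Bochner_Integration.integrable_sum sq_int)
    also have "\<dots> = real (2 * n + 1) * (\<Sum>k\<in>{n\<^sup>2..<(Suc n)\<^sup>2}. expectation (\<lambda>\<omega>. (D k \<omega>)\<^sup>2))"
      by (simp add: sq_int)
    also have "\<dots> \<le> real (2 * n + 1) * (real (2 * n + 1) * C)"
    proof -
      have "card {n\<^sup>2..<(Suc n)\<^sup>2} = 2 * n + 1" by (simp add: power2_eq_square)
      then show ?thesis
        using sum_bounded_above[of "{n\<^sup>2..<(Suc n)\<^sup>2}" "\<lambda>k. expectation (\<lambda>\<omega>. (D k \<omega>)\<^sup>2)" C] bound
        by (intro mult_left_mono) auto
    qed
    finally show ?thesis by (simp add: power2_eq_square mult.assoc)
  qed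
  have "AE \<omega> in M. (\<lambda>n. S (n\<^sup>2) \<omega> / (real n)\<^sup>2) \<longlonglongrightarrow> 0"
  proof (rule AE_tendsto_0_if_second_moments_quadratic)
    show "integrable M (\<lambda>\<omega>. (S (n\<^sup>2) \<omega> / (real n)\<^sup>2)\<^sup>2)" for n
      by (simp add: power_divide S_int)
    show "expectation (\<lambda>\<omega>. (S (n\<^sup>2) \<omega> / (real n)\<^sup>2)\<^sup>2) \<le> C / (real n)\<^sup>2" if "n > 0" for n
      using S_bound[of "n\<^sup>2"] that by (simp add: power_divide field_simps power2_eq_square)
  qed
  moreover have "AE \<omega> in M. (\<lambda>n. T n \<omega> / (real n)\<^sup>2) \<longlonglongrightarrow> 0"
  proof (rule AE_tendsto_0_if_second_moments_quadratic)
    show "integrable M (\<lambda>\<omega>. (T n \<omega> / (real n)\<^sup>2)\<^sup>2)" for n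
      by (simp add: power_divide T_int)
    show "expectation (\<lambda>\<omega>. (T n \<omega> / (real n)\<^sup>2)\<^sup>2) \<le> (9 * C) / (real n)\<^sup>2" if "n > 0" for n
    proof -
      \<comment> \<open>The constant 9 comes from 2 n + 1 \<le> 3 n for n \<ge> 1. After division by
        the fourth power of n the bound is again of order 1 / n^2.\<close>
      have "(real (2 * n + 1))\<^sup>2 \<le> (3 * real n)\<^sup>2" using that by (intro power_mono) auto
      then have "(real (2 * n + 1))\<^sup>2 * C \<le> (9 * (real n)\<^sup>2) * C"
        using C by (intro mult_right_mono) (auto simp: power_mult_distrib)
      then have "expectation (\<lambda>\<omega>. (T n \<omega>)\<^sup>2) \<le> 9 * (real n)\<^sup>2 * C"
        using T_bound[of n] by linarith
      then show ?thesis using that by (simp add: power_divide field_simps power2_eq_square)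
    qed
  qed
  ultimately show ?thesis
  proof eventually_elim
    case (elim \<omega>)
    \<comment> \<open>An arbitrary n lies in the block that starts at the square of
      \<open>floor_sqrt n\<close>, and this root tends to infinity, so the limits along squares
      carry over to all n.\<close>
    have sqrt_top: "filterlim floor_sqrt at_top at_top"
      unfolding filterlim_at_top
    proof
      fix Z show "\<forall>\<^sub>F n in at_top. Z \<le> floor_sqrt n"
        using eventually_ge_at_top[of "Z\<^sup>2"]
        by eventually_elim (use mono_floor_sqrt' in force)
    qed
    have "(\<lambda>n. \<bar>S (n\<^sup>2) \<omega> / (real n)\<^sup>2\<bar> + T n \<omega> / (real n)\<^sup>2) \<longlonglongrightarrow> \<bar>0\<bar> + 0"
      by (intro tendsto_intros elim)
    then have lim: "(\<lambda>n. \<bar>S ((floor_sqrt n)\<^sup>2) \<omega> / (real (floor_sqrt n))\<^sup>2\<bar> + T (floor_sqrt n) \<omega> / (real (floor_sqrt n))\<^sup>2) \<longlonglongrightarrow> 0"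
      using filterlim_compose[OF _ sqrt_top] by simp
    show "(\<lambda>n. (\<Sum>k<n. D k \<omega>) / real n) \<longlonglongrightarrow> 0"
    proof (rule Lim_null_comparison[OF _ lim])
      show "\<forall>\<^sub>F n in sequentially. norm ((\<Sum>k<n. D k \<omega>) / real n) \<le>
          \<bar>S ((floor_sqrt n)\<^sup>2) \<omega> / (real (floor_sqrt n))\<^sup>2\<bar> + T (floor_sqrt n) \<omega> / (real (floor_sqrt n))\<^sup>2"
        using eventually_gt_at_top[of 0]
      proof eventually_elim
        case (elim n)
        let ?q = "floor_sqrt n"
        have q: "?q > 0" "?q\<^sup>2 \<le> n" "n < (Suc ?q)\<^sup>2" using elim floor_sqrt_bounds[of n] by simp_all
        have "S n \<omega> = S (?q\<^sup>2) \<omega> + (\<Sum>k\<in>{?q\<^sup>2..<n}. D k \<omega>)"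
          unfolding S_def lessThan_atLeast0 using q(2) by (simp add: sum.atLeastLessThan_concat)
        moreover have "\<bar>\<Sum>k\<in>{?q\<^sup>2..<n}. D k \<omega>\<bar> \<le> T ?q \<omega>"
          unfolding T_def using q(3) by (intro order_trans[OF sum_abs] sum_mono2) auto
        ultimately have "\<bar>S n \<omega>\<bar> \<le> \<bar>S (?q\<^sup>2) \<omega>\<bar> + T ?q \<omega>" by linarith
        then have "\<bar>S n \<omega>\<bar> / real n \<le> (\<bar>S (?q\<^sup>2) \<omega>\<bar> + T ?q \<omega>) / real n"
          by (rule divide_right_mono) simp
        also have "\<dots> \<le> (\<bar>S (?q\<^sup>2) \<omega>\<bar> + T ?q \<omega>) / (real ?q)\<^sup>2"
        proof (rule divide_left_mono)
          show "(real ?q)\<^sup>2 \<le> real n" using q(2) by (metis of_nat_le_iff of_nat_power)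
          show "0 \<le> \<bar>S (?q\<^sup>2) \<omega>\<bar> + T ?q \<omega>" by (simp add: T_def sum_nonneg)
        qed (use q elim in simp)
        finally show ?case by (simp add: S_def add_divide_distrib)
      qed
    qed
  qed
qed

section \<open>Functions of the past of an i.i.d. uniform sequence\<close>

text \<open>Adaptedness, expressed pointwise on paths in place of a filtration: the entries with
  index below k are known at time k, and entry k is the next draw.\<close>

definition determined_by :: "nat \<Rightarrow> ((nat \<Rightarrow> 'a) \<Rightarrow> 'b) \<Rightarrow> bool" where
  "determined_by k F \<longleftrightarrow> (\<forall>t t'. (\<forall>n<k. t n = t' n) \<longrightarrow> F t = F t')"

lemma determined_byD: "determined_by k F \<Longrightarrow> (\<And>n. n < k \<Longrightarrow> t n = t' n) \<Longrightarrow> F t = F t'"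
  by (auto simp: determined_by_def)

lemma determined_by_power: "determined_by k F \<Longrightarrow> determined_by k (\<lambda>t. F t ^ n)"
  unfolding determined_by_def by metis

lemma determined_by_mult:
  "determined_by k F \<Longrightarrow> determined_by k G \<Longrightarrow> determined_by k (\<lambda>t. F t * G t)"
  unfolding determined_by_def by metis

lemma determined_by_mono: "determined_by j F \<Longrightarrow> j \<le> k \<Longrightarrow> determined_by k F"
  unfolding determined_by_def by (meson less_le_trans)

lemma determined_by_Suc:
  "(\<And>e. determined_by k (\<lambda>t. F t e)) \<Longrightarrow> determined_by (Suc k) (\<lambda>t. F t (t k))"
  unfolding determined_by_def by (metis lessI less_SucI)

text \<open>With \<open>count_space E\<close> as the target, measurability forces every draw into
  \<open>E\<close> at each point of the space.\<close>

locale iid_uniform = prob_space M for M :: "'w measure" +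
  fixes E :: "'a set" and \<theta> :: "nat \<Rightarrow> 'w \<Rightarrow> 'a"
  assumes finite_E: "finite E"
    and indep_\<theta>: "indep_vars (\<lambda>_. count_space E) \<theta> UNIV"
    and uniform: "\<And>k e. e \<in> E \<Longrightarrow> prob {\<omega> \<in> space M. \<theta> k \<omega> = e} = 1 / real (card E)"
begin

abbreviation path :: "'w \<Rightarrow> nat \<Rightarrow> 'a" where "path \<omega> \<equiv> (\<lambda>n. \<theta> n \<omega>)"

lemma measurable_\<theta> [measurable]: "\<theta> k \<in> measurable M (count_space E)"
  using indep_\<theta> by (simp add: indep_vars_def)

lemma path_in: "\<omega> \<in> space M \<Longrightarrow> path \<omega> k \<in> E"
  using measurable_space[OF measurable_\<theta>] by simp

lemma PiM_E: "finite A \<Longrightarrow> PiM A (\<lambda>_. count_space E) = count_space (PiE A (\<lambda>_. E))"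
  using finite_E by (intro count_space_PiM_finite countable_finite)

lemma determined_by_restrict: "determined_by k F \<Longrightarrow> F (restrict t {..<k}) = F t"
  by (erule determined_byD) simp

text \<open>A path restricted to the first k entries takes finitely many values, so \<open>F\<close>
  is bounded and measurable along it.\<close>

lemma integrable_determined:
  fixes F :: "(nat \<Rightarrow> 'a) \<Rightarrow> real"
  assumes "determined_by k F"
  shows "integrable M (\<lambda>\<omega>. F (path \<omega>))"
proof -
  let ?P = "PiE {..<k} (\<lambda>_. E)"
  have [simp]: "(\<lambda>\<omega>. restrict (path \<omega>) {..<k}) \<in> measurable M (count_space ?P)"
    unfolding PiM_E[OF finite_lessThan, symmetric] by (intro measurable_restrict) simp
  have fin: "finite ?P" using finite_E by (simp add: finite_PiE)
  have "integrable M (\<lambda>\<omega>. F (restrict (path \<omega>) {..<k}))"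
  proof (rule integrable_const_bound)
    show "AE \<omega> in M. norm (F (restrict (path \<omega>) {..<k})) \<le> Max ((\<lambda>t. norm (F t)) ` ?P)"
      using fin path_in by (intro AE_I2 Max_ge) auto
    show "(\<lambda>\<omega>. F (restrict (path \<omega>) {..<k})) \<in> borel_measurable M"
      by (rule measurable_compose[where g = F and N = "count_space ?P"]) simp_all
  qed
  then show ?thesis by (simp add: determined_by_restrict[OF assms])
qed

text \<open>Integrated form of conditioning on the past: split according to the value of the next
  draw, then factor by independence.\<close>

lemma expectation_next:
  fixes \<Phi> :: "(nat \<Rightarrow> 'a) \<Rightarrow> 'a \<Rightarrow> real"
  assumes det: "\<And>e. determined_by k (\<lambda>t. \<Phi> t e)"
  shows "expectation (\<lambda>\<omega>. \<Phi> (path \<omega>) (\<theta> k \<omega>))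
    = (\<Sum>e\<in>E. expectation (\<lambda>\<omega>. \<Phi> (path \<omega>) e)) / real (card E)"
proof -
  have ind: "expectation (\<lambda>\<omega>. indicator {e} (\<theta> k \<omega>) * \<Phi> (path \<omega>) e)
      = expectation (\<lambda>\<omega>. \<Phi> (path \<omega>) e) / real (card E)"
    and int: "integrable M (\<lambda>\<omega>. indicator {e} (\<theta> k \<omega>) * \<Phi> (path \<omega>) e)" if "e \<in> E" for e
  proof -
    let ?P = "\<lambda>A. PiM A (\<lambda>_::nat. count_space E)"
    \<comment> \<open>The index sets are disjoint, so the next draw is independent of the past;
      \<open>det\<close> allows \<open>\<Phi>\<close> to be evaluated on the restricted
      path.\<close>
    have "indep_var (?P {k}) (\<lambda>\<omega>. restrict (path \<omega>) {k}) (?P {..<k}) (\<lambda>\<omega>. restrict (path \<omega>) {..<k})"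
      by (rule indep_var_restrict[OF indep_\<theta>]) auto
    then have "indep_var borel ((\<lambda>f. indicator {e} (f k) :: real) \<circ> (\<lambda>\<omega>. restrict (path \<omega>) {k}))
        borel ((\<lambda>f. \<Phi> f e) \<circ> (\<lambda>\<omega>. restrict (path \<omega>) {..<k}))"
      by (rule indep_var_compose) (simp_all add: PiM_E)
    then have iv: "indep_var borel (\<lambda>\<omega>. indicator {e} (\<theta> k \<omega>) :: real) borel (\<lambda>\<omega>. \<Phi> (path \<omega>) e)"
      by (simp add: comp_def determined_by_restrict[OF det])
    have int1: "integrable M (\<lambda>\<omega>. indicator {e} (\<theta> k \<omega>) :: real)"
      by (rule integrable_determined[of "Suc k"]) (simp add: determined_by_def)
    have int2: "integrable M (\<lambda>\<omega>. \<Phi> (path \<omega>) e)" by (rule integrable_determined[OF det])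
    have "expectation (\<lambda>\<omega>. indicator {e} (\<theta> k \<omega>)) = expectation (indicator {\<omega> \<in> space M. \<theta> k \<omega> = e})"
      by (intro Bochner_Integration.integral_cong) (auto simp: indicator_def)
    also have "\<dots> = 1 / real (card E)"
      using uniform[OF that] by simp
    finally show "expectation (\<lambda>\<omega>. indicator {e} (\<theta> k \<omega>) * \<Phi> (path \<omega>) e)
      = expectation (\<lambda>\<omega>. \<Phi> (path \<omega>) e) / real (card E)"
      by (simp add: indep_var_lebesgue_integral[OF iv int1 int2])
    show "integrable M (\<lambda>\<omega>. indicator {e} (\<theta> k \<omega>) * \<Phi> (path \<omega>) e)"
      by (rule indep_var_integrable[OF iv int1 int2])
  qed
  have "expectation (\<lambda>\<omega>. \<Phi> (path \<omega>) (\<theta> k \<omega>))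
      = expectation (\<lambda>\<omega>. \<Sum>e\<in>E. indicator {e} (\<theta> k \<omega>) * \<Phi> (path \<omega>) e)"
    using path_in finite_E
    by (intro Bochner_Integration.integral_cong refl) (simp add: indicator_def of_bool_def[symmetric] if_distrib cong: if_cong)
  also have "\<dots> = (\<Sum>e\<in>E. expectation (\<lambda>\<omega>. \<Phi> (path \<omega>) e) / real (card E))"
    by (simp add: int ind)
  finally show ?thesis by (simp add: sum_divide_distrib)
qed

text \<open>The mean of \<open>W k\<close> over \<open>E\<close> is its conditional mean given the
  past. Subtracting it leaves martingale differences \<open>V k\<close>, which are orthogonal and
  have no larger second moments.\<close>

lemma strong_law_conditional:
  fixes W :: "nat \<Rightarrow> (nat \<Rightarrow> 'a) \<Rightarrow> 'a \<Rightarrow> real"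
  assumes det: "\<And>k e. determined_by k (\<lambda>t. W k t e)"
    and bound: "\<And>k. expectation (\<lambda>\<omega>. (W k (path \<omega>) (\<theta> k \<omega>))\<^sup>2) \<le> C"
  shows "AE \<omega> in M. (\<lambda>n. (\<Sum>k<n. W k (path \<omega>) (\<theta> k \<omega>)
      - (\<Sum>e\<in>E. W k (path \<omega>) e) / real (card E)) / real n) \<longlonglongrightarrow> 0"
proof -
  define V where "V = (\<lambda>k t e. W k t e - (\<Sum>e\<in>E. W k t e) / real (card E))"
  have V_det: "determined_by k (\<lambda>t. V k t e)" for k e
    unfolding determined_by_def
  proof safe
    fix t t' :: "nat \<Rightarrow> 'a" assume "\<forall>n<k. t n = t' n"
    then have "W k t e = W k t' e" for e using determined_byD[OF det] by blast
    then show "V k t e = V k t' e" by (simp add: V_def)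
  qed
  have V_det': "determined_by (Suc k) (\<lambda>t. V k t (t k))" for k
    by (rule determined_by_Suc) (rule V_det)
  have E_ne: "E \<noteq> {}" using path_in not_empty by auto
  have V_sum: "(\<Sum>e\<in>E. V k t e) = 0" for k t
    using E_ne finite_E by (simp add: V_def sum_subtractf)
  have "AE \<omega> in M. (\<lambda>n. (\<Sum>k<n. V k (path \<omega>) (\<theta> k \<omega>)) / real n) \<longlonglongrightarrow> 0"
  proof (rule strong_law_orthogonal)
    show "integrable M (\<lambda>\<omega>. V j (path \<omega>) (\<theta> j \<omega>) * V k (path \<omega>) (\<theta> k \<omega>))" for j k
      by (rule integrable_determined[of "max (Suc j) (Suc k)" "\<lambda>t. V j t (t j) * V k t (t k)"])
         (rule determined_by_mult; rule determined_by_mono[OF V_det']; simp)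
    show "(\<lambda>\<omega>. V k (path \<omega>) (\<theta> k \<omega>)) \<in> borel_measurable M" for k
      using integrable_determined[OF V_det'[of k]] by (rule borel_measurable_integrable)
    show "expectation (\<lambda>\<omega>. V j (path \<omega>) (\<theta> j \<omega>) * V k (path \<omega>) (\<theta> k \<omega>)) = 0" if "j < k" for j k
    proof -
      \<comment> \<open>As j < k, the earlier factor already belongs to the past at time k.
        Averaging over the next draw therefore acts only on \<open>V k\<close> and gives 0.\<close>
      have d: "determined_by k (\<lambda>t. V j t (t j) * V k t e)" for e
        by (rule determined_by_mult[OF determined_by_mono[OF V_det'] V_det]) (use that in simp)
      have "(\<Sum>e\<in>E. expectation (\<lambda>\<omega>. V j (path \<omega>) (\<theta> j \<omega>) * V k (path \<omega>) e))
          = expectation (\<lambda>\<omega>. \<Sum>e\<in>E. V j (path \<omega>) (\<theta> j \<omega>) * V k (path \<omega>) e)"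
        by (rule Bochner_Integration.integral_sum[symmetric]) (rule integrable_determined[OF d])
      also have "\<dots> = 0" by (simp add: sum_distrib_left[symmetric] V_sum)
      finally show ?thesis
        using expectation_next[of k "\<lambda>t e. V j t (t j) * V k t e", OF d] by simp
    qed
    show "expectation (\<lambda>\<omega>. (V k (path \<omega>) (\<theta> k \<omega>))\<^sup>2) \<le> C" for k
    proof -
      have dV: "determined_by k (\<lambda>t. (V k t e)\<^sup>2)" and dW: "determined_by k (\<lambda>t. (W k t e)\<^sup>2)" for e
        by (rule determined_by_power[OF V_det], rule determined_by_power[OF det])
      have le: "(\<Sum>e\<in>E. (V k t e)\<^sup>2) \<le> (\<Sum>e\<in>E. (W k t e)\<^sup>2)" for t
      proof -
        define c where "c = (\<Sum>e\<in>E. W k t e) / real (card E)"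
        \<comment> \<open>Variance decomposition around the mean \<open>c\<close>; the cross term
          vanishes by \<open>V_sum\<close>.\<close>
        have "(\<Sum>e\<in>E. (W k t e)\<^sup>2) = (\<Sum>e\<in>E. (V k t e)\<^sup>2 + 2 * c * V k t e + c\<^sup>2)"
          by (intro sum.cong refl) (simp add: V_def c_def power2_eq_square algebra_simps)
        also have "\<dots> = (\<Sum>e\<in>E. (V k t e)\<^sup>2) + real (card E) * c\<^sup>2"
          by (simp add: sum.distrib sum_distrib_left[symmetric] V_sum)
        finally show ?thesis by simp
      qed
      have "(\<Sum>e\<in>E. expectation (\<lambda>\<omega>. (V k (path \<omega>) e)\<^sup>2)) = expectation (\<lambda>\<omega>. \<Sum>e\<in>E. (V k (path \<omega>) e)\<^sup>2)"
        by (rule Bochner_Integration.integral_sum[symmetric]) (rule integrable_determined[OF dV])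
      also have "\<dots> \<le> expectation (\<lambda>\<omega>. \<Sum>e\<in>E. (W k (path \<omega>) e)\<^sup>2)"
        by (intro integral_mono Bochner_Integration.integrable_sum integrable_determined[OF dV] integrable_determined[OF dW] le)
      also have "\<dots> = (\<Sum>e\<in>E. expectation (\<lambda>\<omega>. (W k (path \<omega>) e)\<^sup>2))"
        by (rule Bochner_Integration.integral_sum) (rule integrable_determined[OF dW])
      finally have "expectation (\<lambda>\<omega>. (V k (path \<omega>) (\<theta> k \<omega>))\<^sup>2) \<le> expectation (\<lambda>\<omega>. (W k (path \<omega>) (\<theta> k \<omega>))\<^sup>2)"
        using expectation_next[of k "\<lambda>t e. (V k t e)\<^sup>2", OF dV]
          expectation_next[of k "\<lambda>t e. (W k t e)\<^sup>2", OF dW] by (simp add: divide_right_mono)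
      then show ?thesis using bound[of k] by linarith
    qed
  qed
  then show ?thesis by (simp add: V_def)
qed

end

section \<open>Randomized gossip\<close>

text \<open>The changes at the two endpoints are opposite, so a step is a move along
  \<open>edge_dir (t k)\<close> by \<gamma> times the current residual of that edge's
  equation.\<close>

lemma gossip_Suc_eq:
  assumes "fst (t k) \<noteq> snd (t k)"
  shows "gossip \<gamma> b t (Suc k) = gossip \<gamma> b t k
    + (\<gamma> * (b (t k) - edge_dir (t k) \<bullet> gossip \<gamma> b t k)) *\<^sub>R edge_dir (t k)"
  using assms by (auto simp: vec_eq_iff Let_def inner_edge_dir edge_dir_nth algebra_simps)

lemma gossip_determined: "determined_by k (\<lambda>t. gossip \<gamma> b t k)"
  unfolding determined_by_def
proof safe
  fix t t' :: "nat \<Rightarrow> 'a \<times> 'a" assume "\<forall>n<k. t n = t' n"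
  then show "gossip \<gamma> b t k = gossip \<gamma> b t' k"
    by (induction k) (simp_all add: Let_def)
qed

definition touches :: "'v \<Rightarrow> 'v \<times> 'v \<Rightarrow> real" where
  "touches h e = of_bool (h = fst e \<or> h = snd e)"

lemma updates_eq: "real (updates t n h) = (\<Sum>k<n. touches h (t k))"
  by (induction n) (auto simp: touches_def)

text \<open>Multiplying by the counter clears the division and turns the recursive average into a
  running sum. This form also covers a node that has not been updated yet, where both sides are
  0.\<close>

lemma updates_times_local_avg:
  "real (updates t n h) * local_avg \<gamma> b t n $ h
    = (\<Sum>k<n. touches h (t k) * gossip \<gamma> b t (Suc k) $ h)"
proof (induction n)
  case (Suc n)
  then show ?case
    by (cases "h = fst (t n) \<or> h = snd (t n)")
       (auto simp del: gossip.simps simp: touches_def)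
qed simp

text \<open>The sum is the degree of \<open>h\<close>. A path from \<open>h\<close> to some other
  node must begin with an edge at \<open>h\<close>.\<close>

lemma sum_touches_pos:
  fixes E :: "('v::finite \<times> 'v) set"
  assumes "weakly_connected E" "CARD('v) > 1"
  shows "0 < (\<Sum>e\<in>E. touches h e)"
proof -
  obtain u where u: "u \<noteq> h"
    using assms(2) by (metis (full_types) UNIV_eq_I card_1_singleton_iff insertI1 less_irrefl One_nat_def)
  have "(h, u) \<in> (E \<union> E\<inverse>)\<^sup>*" using assms(1) by (simp add: weakly_connected_def)
  then obtain w where "(h, w) \<in> E \<union> E\<inverse>" using u by (metis converse_rtranclE)
  then obtain e where "e \<in> E" "touches h e = 1" by (auto simp: touches_def)
  then show ?thesis by (intro sum_pos2[of E e]) (auto simp: touches_def)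
qed

section \<open>The error recursion and its second moments\<close>

locale randomized_gossip = iid_uniform M E \<theta>
  for M :: "'w measure" and E :: "('v::{finite,linorder} \<times> 'v) set" and \<theta> +
  fixes b :: "'v \<times> 'v \<Rightarrow> real" and \<gamma> :: real
  assumes oriented: "oriented_graph E"
    and connected: "weakly_connected E"
    and two_nodes: "CARD('v) > 1"
    and \<gamma>_pos: "0 < \<gamma>" and \<gamma>_less_1: "\<gamma> < 1"
begin

text \<open>The noise that drives the error recursion; it keeps the error from converging, but by
  the normal equations it averages out over the edges.\<close>

definition residual :: "'v \<times> 'v \<Rightarrow> real" where
  "residual e = b e - edge_dir e \<bullet> x_loc E b"

definition err :: "nat \<Rightarrow> (nat \<Rightarrow> 'v \<times> 'v) \<Rightarrow> (real, 'v) vec" where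
  "err k t = gossip \<gamma> b t k - x_loc E b"

text \<open>The gossip step in coordinates centred at \<open>x_loc\<close>, with the edge as an
  argument so that means over \<open>E\<close> can be formed.\<close>

definition err_step :: "(real, 'v) vec \<Rightarrow> 'v \<times> 'v \<Rightarrow> (real, 'v) vec" where
  "err_step y e = y + (\<gamma> * (residual e - edge_dir e \<bullet> y)) *\<^sub>R edge_dir e"

lemma card_E_pos: "0 < card E"
  using path_in not_empty finite_E by (metis card_gt_0_iff empty_iff equals0I)

lemma edge_neq: "e \<in> E \<Longrightarrow> fst e \<noteq> snd e"
  using oriented by (force simp: oriented_graph_def)

lemma sum_residual: "(\<Sum>e\<in>E. residual e *\<^sub>R edge_dir e) = 0"
  unfolding residual_def by (rule x_loc_properties[OF oriented connected])

lemma err_Suc: "t k \<in> E \<Longrightarrow> err (Suc k) t = err_step (err k t) (t k)"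
  using gossip_Suc_eq[of t k \<gamma> b] edge_neq
  by (simp add: err_def err_step_def residual_def inner_diff_right del: gossip.simps)

text \<open>The initial error \<open>- x_loc E b\<close> has mean zero, and each step moves along an
  edge direction, which is orthogonal to 1.\<close>

lemma err_mean_zero:
  assumes "\<And>k. t k \<in> E"
  shows "1 \<bullet> err k t = 0"
proof (induction k)
  case 0
  show ?case using x_loc_properties(1)[OF oriented connected] by (simp add: err_def inner_diff_right)
next
  case (Suc k)
  then show ?case using assms by (simp add: err_Suc err_step_def inner_add_right)
qed

lemma err_determined: "determined_by k (\<lambda>t. f (err k t))"
  using gossip_determined[of k \<gamma> b] unfolding determined_by_def err_def by metis

lemma integrable_err:
  fixes f :: "(real, 'v) vec \<Rightarrow> real"
  shows "integrable M (\<lambda>\<omega>. f (err k (path \<omega>)))"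
  by (rule integrable_determined[OF err_determined])

text \<open>Expansion of the square, using that an edge direction has squared norm 2. The cross term
  is kept as an inner product with \<open>residual e *\<^sub>R edge_dir e\<close> so that
  \<open>sum_residual\<close> removes it after summation over \<open>E\<close>.\<close>

lemma err_step_norm:
  assumes "e \<in> E"
  shows "(norm (err_step y e))\<^sup>2 = (norm y)\<^sup>2 - 2 * \<gamma> * (1 - \<gamma>) * (edge_dir e \<bullet> y)\<^sup>2
    + 2 * \<gamma> * (1 - 2 * \<gamma>) * (y \<bullet> (residual e *\<^sub>R edge_dir e)) + 2 * \<gamma>\<^sup>2 * (residual e)\<^sup>2"
proof -
  have "edge_dir e \<bullet> edge_dir e = 2"
    using edge_neq[OF assms] by (simp add: inner_edge_dir edge_dir_nth)
  moreover have "(norm (y + c *\<^sub>R a))\<^sup>2 = (norm y)\<^sup>2 + 2 * c * (a \<bullet> y) + c\<^sup>2 * (a \<bullet> a)"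
    for c and a :: "(real, 'v) vec"
    unfolding power2_norm_eq_inner
    by (simp add: inner_add_left inner_add_right inner_commute[of y a] power2_eq_square distrib_left)
  ultimately have "(norm (err_step y e))\<^sup>2 = (norm y)\<^sup>2
      + 2 * (\<gamma> * (residual e - edge_dir e \<bullet> y)) * (edge_dir e \<bullet> y)
      + (\<gamma> * (residual e - edge_dir e \<bullet> y))\<^sup>2 * 2"
    by (simp only: err_step_def)
  also have "\<dots> = (norm y)\<^sup>2 - 2 * \<gamma> * (1 - \<gamma>) * (edge_dir e \<bullet> y)\<^sup>2
      + 2 * \<gamma> * (1 - 2 * \<gamma>) * (residual e * (edge_dir e \<bullet> y)) + 2 * \<gamma>\<^sup>2 * (residual e)\<^sup>2"
    by algebra
  finally show ?thesis by (simp add: inner_commute)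
qed

text \<open>The first-order terms of the squared norm average out over the edges, by the normal
  equations for the residual of \<open>x_loc\<close>.\<close>

lemma second_moment_drift:
  obtains c R where "0 < c" "c \<le> 1"
    "\<And>y. 1 \<bullet> y = 0 \<Longrightarrow> (\<Sum>e\<in>E. (norm (err_step y e))\<^sup>2) / card E \<le> (1 - c) * (norm y)\<^sup>2 + R"
proof -
  obtain d where d: "0 < d"
    "\<And>y. 1 \<bullet> y = 0 \<Longrightarrow> d * (norm y)\<^sup>2 \<le> (\<Sum>e\<in>E. (edge_dir e \<bullet> y)\<^sup>2)"
    using dirichlet_coercive[OF connected] by blast
  \<comment> \<open>The contraction rate is cut off at 1 to keep \<open>1 - c\<close> nonnegative,
    as the induction on second moments requires.\<close>
  define c where "c = min 1 (2 * \<gamma> * (1 - \<gamma>) * d / card E)"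
  define R where "R = 2 * \<gamma>\<^sup>2 * (\<Sum>e\<in>E. (residual e)\<^sup>2) / card E"
  show thesis
  proof (rule that[of c R])
    show "0 < c" using d(1) \<gamma>_pos \<gamma>_less_1 card_E_pos by (simp add: c_def)
    show "c \<le> 1" by (simp add: c_def)
    fix y :: "(real, 'v) vec" assume y: "1 \<bullet> y = 0"
    have "(\<Sum>e\<in>E. (norm (err_step y e))\<^sup>2)
        = card E * (norm y)\<^sup>2 - 2 * \<gamma> * (1 - \<gamma>) * (\<Sum>e\<in>E. (edge_dir e \<bullet> y)\<^sup>2)
          + 2 * \<gamma> * (1 - 2 * \<gamma>) * (y \<bullet> (\<Sum>e\<in>E. residual e *\<^sub>R edge_dir e))
          + 2 * \<gamma>\<^sup>2 * (\<Sum>e\<in>E. (residual e)\<^sup>2)"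
      by (simp add: err_step_norm sum.distrib sum_subtractf sum_distrib_left inner_sum_right)
    also have "\<dots> = card E * (norm y)\<^sup>2 - 2 * \<gamma> * (1 - \<gamma>) * (\<Sum>e\<in>E. (edge_dir e \<bullet> y)\<^sup>2)
          + card E * R"
      using card_E_pos by (simp add: sum_residual R_def)
    also have "\<dots> \<le> card E * (norm y)\<^sup>2 - 2 * \<gamma> * (1 - \<gamma>) * (d * (norm y)\<^sup>2) + card E * R"
      using d(2)[OF y] \<gamma>_pos \<gamma>_less_1 by (simp add: mult_left_mono)
    also have "\<dots> = card E * ((1 - 2 * \<gamma> * (1 - \<gamma>) * d / card E) * (norm y)\<^sup>2 + R)"
    proof -
      have *: "m * ((1 - a / m) * s + R) = m * s - a * s + m * R" if "m \<noteq> 0" for m a s :: real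
        using that by (simp add: distrib_left left_diff_distrib right_diff_distrib)
      show ?thesis
        by (subst *) (use card_E_pos in \<open>auto simp: mult.assoc card_gt_0_iff\<close>)
    qed
    also have "\<dots> \<le> card E * ((1 - c) * (norm y)\<^sup>2 + R)"
      by (intro mult_left_mono add_right_mono mult_right_mono) (auto simp: c_def)
    finally show "(\<Sum>e\<in>E. (norm (err_step y e))\<^sup>2) / card E \<le> (1 - c) * (norm y)\<^sup>2 + R"
      using card_E_pos by (simp add: pos_divide_le_eq mult.commute[of _ "real (card E)"])
  qed
qed

lemma second_moment_bounded:
  obtains B where "\<And>k. expectation (\<lambda>\<omega>. (norm (err k (path \<omega>)))\<^sup>2) \<le> B"
proof -
  obtain c R where c: "0 < c" "c \<le> 1" and drift:
    "\<And>y. 1 \<bullet> y = 0 \<Longrightarrow> (\<Sum>e\<in>E. (norm (err_step y e))\<^sup>2) / card E \<le> (1 - c) * (norm y)\<^sup>2 + R"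
    using second_moment_drift by blast
  \<comment> \<open>The recursion with factor \<open>1 - c\<close> and offset \<open>R\<close> has
    fixed point \<open>R / c\<close>; the other entry is the squared norm of the initial
    error.\<close>
  define B where "B = max ((norm (x_loc E b))\<^sup>2) (R / c)"
  have "R \<le> c * B" using c(1) by (simp add: B_def field_simps max_def)
  have "expectation (\<lambda>\<omega>. (norm (err k (path \<omega>)))\<^sup>2) \<le> B" for k
  proof (induction k)
    case 0
    show ?case by (simp add: err_def B_def prob_space)
  next
    case (Suc k)
    have "expectation (\<lambda>\<omega>. (norm (err (Suc k) (path \<omega>)))\<^sup>2)
        = expectation (\<lambda>\<omega>. (norm (err_step (err k (path \<omega>)) (\<theta> k \<omega>)))\<^sup>2)"
      by (intro Bochner_Integration.integral_cong refl) (simp add: err_Suc path_in)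
    also have "\<dots> = (\<Sum>e\<in>E. expectation (\<lambda>\<omega>. (norm (err_step (err k (path \<omega>)) e))\<^sup>2)) / card E"
      by (rule expectation_next[of k "\<lambda>t e. (norm (err_step (err k t) e))\<^sup>2"]) (rule err_determined)
    also have "\<dots> = expectation (\<lambda>\<omega>. (\<Sum>e\<in>E. (norm (err_step (err k (path \<omega>)) e))\<^sup>2) / card E)"
      by (simp add: integrable_err[of "\<lambda>y. (norm (err_step y _))\<^sup>2"])
    also have "\<dots> \<le> expectation (\<lambda>\<omega>. (1 - c) * (norm (err k (path \<omega>)))\<^sup>2 + R)"
      by (rule integral_mono[OF integrable_err[of "\<lambda>y. (\<Sum>e\<in>E. (norm (err_step y e))\<^sup>2) / card E"]
            integrable_err[of "\<lambda>y. (1 - c) * (norm y)\<^sup>2 + R"]])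
         (intro drift err_mean_zero path_in)
    also have "\<dots> = (1 - c) * expectation (\<lambda>\<omega>. (norm (err k (path \<omega>)))\<^sup>2) + R"
      using integrable_err[of "\<lambda>y. (norm y)\<^sup>2" k] by (simp add: prob_space)
    also have "\<dots> \<le> (1 - c) * B + c * B"
      using Suc c(2) \<open>R \<le> c * B\<close> by (intro add_mono mult_left_mono) auto
    finally show ?case by (simp add: algebra_simps)
  qed
  then show thesis by (rule that)
qed

section \<open>Strong laws for time averages along the error process\<close>

text \<open>The errors before and after a step both have uniformly bounded second moments, so
  quadratic growth in the two supplies the bound for \<open>strong_law_conditional\<close>.\<close>

lemma strong_law_err:
  fixes f :: "(real, 'v) vec \<Rightarrow> 'v \<times> 'v \<Rightarrow> real"
  assumes "\<And>y e. e \<in> E \<Longrightarrow> (f y e)\<^sup>2 \<le> A + A * (norm y)\<^sup>2 + A * (norm (err_step y e))\<^sup>2"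
    and "0 \<le> A"
  shows "AE \<omega> in M. (\<lambda>n. (\<Sum>k<n. f (err k (path \<omega>)) (\<theta> k \<omega>)
      - (\<Sum>e\<in>E. f (err k (path \<omega>)) e) / real (card E)) / real n) \<longlonglongrightarrow> 0"
proof -
  obtain B where B: "\<And>k. expectation (\<lambda>\<omega>. (norm (err k (path \<omega>)))\<^sup>2) \<le> B"
    using second_moment_bounded by blast
  show ?thesis
  proof (rule strong_law_conditional[of "\<lambda>k t e. f (err k t) e"])
    show "determined_by k (\<lambda>t. f (err k t) e)" for k e by (rule err_determined)
    show "expectation (\<lambda>\<omega>. (f (err k (path \<omega>)) (\<theta> k \<omega>))\<^sup>2) \<le> A + A * B + A * B" for k
    proof -
      note int = integrable_err[of "\<lambda>y. (norm y)\<^sup>2"]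
      have det: "determined_by (Suc k) (\<lambda>t. (f (err k t) (t k))\<^sup>2)"
        by (rule determined_by_Suc[of k "\<lambda>t e. (f (err k t) e)\<^sup>2"]) (rule err_determined)
      have "expectation (\<lambda>\<omega>. (f (err k (path \<omega>)) (\<theta> k \<omega>))\<^sup>2)
          \<le> expectation (\<lambda>\<omega>. A + A * (norm (err k (path \<omega>)))\<^sup>2 + A * (norm (err (Suc k) (path \<omega>)))\<^sup>2)"
      proof (rule integral_mono[OF integrable_determined[OF det]])
        show "integrable M (\<lambda>\<omega>. A + A * (norm (err k (path \<omega>)))\<^sup>2 + A * (norm (err (Suc k) (path \<omega>)))\<^sup>2)"
          using int[of k] int[of "Suc k"] by simp
        show "(f (err k (path \<omega>)) (\<theta> k \<omega>))\<^sup>2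
            \<le> A + A * (norm (err k (path \<omega>)))\<^sup>2 + A * (norm (err (Suc k) (path \<omega>)))\<^sup>2"
          if "\<omega> \<in> space M" for \<omega>
          using assms(1)[of "\<theta> k \<omega>" "err k (path \<omega>)"] path_in[OF that, of k] by (simp add: err_Suc)
      qed
      also have "\<dots> = A + A * expectation (\<lambda>\<omega>. (norm (err k (path \<omega>)))\<^sup>2)
          + A * expectation (\<lambda>\<omega>. (norm (err (Suc k) (path \<omega>)))\<^sup>2)"
        using int[of k] int[of "Suc k"] by (simp add: prob_space)
      also have "\<dots> \<le> A + A * B + A * B"
        using B assms(2) by (intro add_mono mult_left_mono) auto
      finally show ?thesis .
    qed
  qed
qed

text \<open>Bounded second moments become summable after division by n^2. The result disposes of the
  boundary term when the increments are telescoped.\<close>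

lemma AE_err_sublinear: "AE \<omega> in M. \<forall>h. (\<lambda>n. err n (path \<omega>) $ h / real n) \<longlonglongrightarrow> 0"
unfolding AE_all_countable
proof (intro allI, goal_cases)
  case (1 h)
  obtain B where B: "\<And>k. expectation (\<lambda>\<omega>. (norm (err k (path \<omega>)))\<^sup>2) \<le> B"
    using second_moment_bounded by blast
  show ?case
  proof (rule AE_tendsto_0_if_second_moments_quadratic)
    show "integrable M (\<lambda>\<omega>. (err n (path \<omega>) $ h / real n)\<^sup>2)" for n
      by (rule integrable_err[of "\<lambda>y. (y $ h / real n)\<^sup>2"])
    show "expectation (\<lambda>\<omega>. (err n (path \<omega>) $ h / real n)\<^sup>2) \<le> B / (real n)\<^sup>2" if "n > 0" for n
    proof -
      have "expectation (\<lambda>\<omega>. (err n (path \<omega>) $ h / real n)\<^sup>2)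
          \<le> expectation (\<lambda>\<omega>. (norm (err n (path \<omega>)))\<^sup>2 / (real n)\<^sup>2)"
        using component_le_norm_cart
        by (intro integral_mono integrable_err[of "\<lambda>y. (y $ h / real n)\<^sup>2"]
            integrable_err[of "\<lambda>y. (norm y)\<^sup>2 / (real n)\<^sup>2"])
           (auto simp: power_divide intro!: divide_right_mono abs_le_square_iff[THEN iffD1])
      also have "\<dots> \<le> B / (real n)\<^sup>2"
        using B[of n] by (simp add: divide_right_mono)
      finally show ?thesis .
    qed
  qed
qed

text \<open>The residuals cancel by the normal equations, which leaves a linear mean drift.\<close>

lemma sum_err_step:
  "(\<Sum>e\<in>E. err_step y e - y) = - (\<gamma> *\<^sub>R laplacian E y)"
proof -
  have "(\<Sum>e\<in>E. err_step y e - y) = \<gamma> *\<^sub>R ((\<Sum>e\<in>E. residual e *\<^sub>R edge_dir e) - laplacian E y)"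
    by (simp add: err_step_def laplacian_def scaleR_sum_right sum_subtractf[symmetric] algebra_simps)
  then show ?thesis by (simp add: sum_residual)
qed

text \<open>An edge that misses \<open>h\<close> leaves coordinate \<open>h\<close> unchanged, so
  the weight \<open>touches h e\<close> matters only for the old value; the increments sum as in
  \<open>sum_err_step\<close>.\<close>

lemma sum_touches_err_step:
  "(\<Sum>e\<in>E. touches h e * err_step y e $ h)
    = (\<Sum>e\<in>E. touches h e) * y $ h - \<gamma> * laplacian E y $ h"
proof -
  have "touches h e * err_step y e $ h = touches h e * y $ h + (err_step y e - y) $ h" for e
    by (auto simp: touches_def err_step_def edge_dir_nth)
  then have "(\<Sum>e\<in>E. touches h e * err_step y e $ h)
      = (\<Sum>e\<in>E. touches h e * y $ h) + (\<Sum>e\<in>E. err_step y e - y) $ h"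
    by (simp add: sum.distrib)
  then show ?thesis by (simp add: sum_err_step sum_distrib_right)
qed

lemma nth_square_le: "(y $ h)\<^sup>2 \<le> (norm (y :: (real, 'v) vec))\<^sup>2"
  using component_le_norm_cart[of y h] by (simp add: abs_le_square_iff[symmetric])

lemma AE_average_increment:
  "AE \<omega> in M. \<forall>h. (\<lambda>n. (\<Sum>k<n. err_step (err k (path \<omega>)) (\<theta> k \<omega>) $ h - err k (path \<omega>) $ h
      - (- (\<gamma> * laplacian E (err k (path \<omega>)) $ h)) / real (card E)) / real n) \<longlonglongrightarrow> 0"
unfolding AE_all_countable
proof (intro allI, goal_cases)
  case (1 h)
  have 1: "(\<Sum>e\<in>E. err_step y e $ h - y $ h) = - (\<gamma> * laplacian E y $ h)" for y
    using arg_cong[OF sum_err_step[of y], of "\<lambda>v. v $ h"] by simp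
  have 2: "(u $ h - v $ h)\<^sup>2 \<le> 2 * (norm v)\<^sup>2 + 2 * (norm u)\<^sup>2" for u v :: "(real, 'v) vec"
  proof -
    have "(u $ h - v $ h)\<^sup>2 \<le> 2 * (v $ h)\<^sup>2 + 2 * (u $ h)\<^sup>2"
      using sum_squares_bound[of "u $ h" "- v $ h"] by (simp add: power2_diff)
    then show ?thesis using nth_square_le[of u h] nth_square_le[of v h] by linarith
  qed
  have "(err_step y e $ h - y $ h)\<^sup>2 \<le> 2 + 2 * (norm y)\<^sup>2 + 2 * (norm (err_step y e))\<^sup>2" for y e
    using 2[of "err_step y e" y] by linarith
  then show ?case using strong_law_err[of "\<lambda>y e. err_step y e $ h - y $ h" 2] by (simp only: 1)
qed

text \<open>The summand is the error at \<open>h\<close> just after an update of \<open>h\<close>,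
  the quantity that the local average accumulates.\<close>

lemma AE_average_touched:
  "AE \<omega> in M. \<forall>h. (\<lambda>n. (\<Sum>k<n. touches h (\<theta> k \<omega>) * err_step (err k (path \<omega>)) (\<theta> k \<omega>) $ h
      - ((\<Sum>e\<in>E. touches h e) * err k (path \<omega>) $ h - \<gamma> * laplacian E (err k (path \<omega>)) $ h)
        / real (card E)) / real n) \<longlonglongrightarrow> 0"
unfolding AE_all_countable
proof (intro allI, goal_cases)
  case (1 h)
  have "(touches h e * err_step y e $ h)\<^sup>2 \<le> 1 + 1 * (norm y)\<^sup>2 + 1 * (norm (err_step y e))\<^sup>2" for y e
    using nth_square_le[of "err_step y e" h] by (auto simp: touches_def add_increasing)
  then show ?case
    using strong_law_err[of "\<lambda>y e. touches h e * err_step y e $ h" 1] by (simp only: sum_touches_err_step)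
qed

text \<open>Law of large numbers for the update counter of \<open>h\<close>, obtained from an
  observable that ignores the error.\<close>

lemma AE_average_touches:
  "AE \<omega> in M. \<forall>h. (\<lambda>n. (\<Sum>k<n. touches h (\<theta> k \<omega>) - (\<Sum>e\<in>E. touches h e) / real (card E)) / real n)
    \<longlonglongrightarrow> 0"
unfolding AE_all_countable
proof (intro allI, goal_cases)
  case (1 h)
  have "(touches h e)\<^sup>2 \<le> 1 + 1 * (norm y)\<^sup>2 + 1 * (norm (err_step y e))\<^sup>2" for y e
    by (auto simp: touches_def)
  then show ?case using strong_law_err[of "\<lambda>y e. touches h e" 1] by simp
qed

text \<open>Telescoping the increments shows that the Laplacian of the time-averaged error vanishes in
  the limit; the error has mean zero, so the time-averaged error itself vanishes.\<close>

lemma average_err_tendsto_0: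
  assumes t: "\<And>k. t k \<in> E"
    and sublinear: "\<And>h. (\<lambda>n. err n t $ h / real n) \<longlonglongrightarrow> 0"
    and increment: "\<And>h. (\<lambda>n. (\<Sum>k<n. err_step (err k t) (t k) $ h - err k t $ h
      - (- (\<gamma> * laplacian E (err k t) $ h)) / real (card E)) / real n) \<longlonglongrightarrow> 0"
  shows "(\<lambda>n. (\<Sum>k<n. laplacian E (err k t) $ h) / real n) \<longlonglongrightarrow> 0"
    and "(\<lambda>n. (\<Sum>k<n. err k t $ h) / real n) \<longlonglongrightarrow> 0"
proof -
  let ?m = "real (card E)"
  have lap: "(\<lambda>n. (\<Sum>k<n. laplacian E (err k t) $ h) / real n) \<longlonglongrightarrow> 0" for h
  proof -
    let ?I = "\<lambda>n. \<Sum>k<n. err_step (err k t) (t k) $ h - err k t $ h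
        - (- (\<gamma> * laplacian E (err k t) $ h)) / ?m"
    have "?I n = err n t $ h - err 0 t $ h + \<gamma> / ?m * (\<Sum>k<n. laplacian E (err k t) $ h)" for n
    proof -
      have "?I n = (\<Sum>k<n. err (Suc k) t $ h - err k t $ h)
          + \<gamma> / ?m * (\<Sum>k<n. laplacian E (err k t) $ h)"
        by (simp add: err_Suc t sum.distrib sum_distrib_left)
      then show ?thesis by (simp only: sum_lessThan_telescope[of "\<lambda>k. err k t $ h"])
    qed
    \<comment> \<open>The telescoped identity, solved for the Laplacian average. It holds at n = 0
      as well, where every quotient is 0.\<close>
    then have eq: "(\<Sum>k<n. laplacian E (err k t) $ h) / real n
        = ?m / \<gamma> * (?I n / real n - err n t $ h / real n + err 0 t $ h / real n)" for n
      using card_E_pos \<gamma>_pos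
      by (simp only: diff_divide_distrib[symmetric] add_divide_distrib[symmetric]) (auto simp: card_gt_0_iff)
    have "(\<lambda>n. ?m / \<gamma> * (?I n / real n - err n t $ h / real n + err 0 t $ h / real n))
        \<longlonglongrightarrow> ?m / \<gamma> * (0 - 0 + 0)"
      by (intro tendsto_intros sublinear increment lim_const_over_n)
    then show ?thesis unfolding eq by simp
  qed
  show "(\<lambda>n. (\<Sum>k<n. laplacian E (err k t) $ h) / real n) \<longlonglongrightarrow> 0" by (rule lap)
  define v where "v = (\<lambda>n. (1 / real n) *\<^sub>R (\<Sum>k<n. err k t))"
  interpret lap: bounded_linear "laplacian E" by (rule bounded_linear_laplacian)
  have "(\<lambda>n. laplacian E (v n)) \<longlonglongrightarrow> 0"
  proof (rule vec_tendstoI)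
    show "(\<lambda>n. laplacian E (v n) $ h) \<longlonglongrightarrow> 0 $ h" for h
      using lap[of h] by (simp add: v_def lap.scaleR lap.sum)
  qed
  then have "(\<lambda>n. norm (laplacian E (v n))) \<longlonglongrightarrow> 0" by (rule tendsto_norm_zero)
  obtain c where c: "0 < c" "\<And>y. 1 \<bullet> y = 0 \<Longrightarrow> c * norm y \<le> norm (laplacian E y)"
    using laplacian_coercive[OF connected] by blast
  have v_le: "norm (v n) \<le> norm (laplacian E (v n)) / c" for n
  proof -
    have "1 \<bullet> v n = 0" by (simp add: v_def inner_sum_right err_mean_zero t)
    then show ?thesis using c(2)[of "v n"] c(1) by (simp add: field_simps)
  qed
  have "v \<longlonglongrightarrow> 0"
  proof (rule Lim_null_comparison)
    show "\<forall>\<^sub>F n in sequentially. norm (v n) \<le> norm (laplacian E (v n)) / c"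
      using v_le by simp
    show "(\<lambda>n. norm (laplacian E (v n)) / c) \<longlonglongrightarrow> 0"
      using \<open>(\<lambda>n. norm (laplacian E (v n))) \<longlonglongrightarrow> 0\<close> by (rule tendsto_divide_zero)
  qed
  then have "(\<lambda>n. v n $ h) \<longlonglongrightarrow> 0 $ h" by (rule tendsto_vec_nth)
  then show "(\<lambda>n. (\<Sum>k<n. err k t $ h) / real n) \<longlonglongrightarrow> 0"
    by (simp add: v_def)
qed

section \<open>Convergence of the local averages\<close>

text \<open>Along a single path, the error of the local average at \<open>h\<close> is the ratio of
  the accumulated error \<open>?Z\<close> to the update count. Divided by n, the former tends to 0
  and the latter to the positive update frequency \<open>d / ?m\<close>.\<close>

lemma local_avg_tendsto:
  assumes t: "\<And>k. t k \<in> E"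
    and sublinear: "\<And>h. (\<lambda>n. err n t $ h / real n) \<longlonglongrightarrow> 0"
    and increment: "\<And>h. (\<lambda>n. (\<Sum>k<n. err_step (err k t) (t k) $ h - err k t $ h
      - (- (\<gamma> * laplacian E (err k t) $ h)) / real (card E)) / real n) \<longlonglongrightarrow> 0"
    and touched: "\<And>h. (\<lambda>n. (\<Sum>k<n. touches h (t k) * err_step (err k t) (t k) $ h
      - ((\<Sum>e\<in>E. touches h e) * err k t $ h - \<gamma> * laplacian E (err k t) $ h)
        / real (card E)) / real n) \<longlonglongrightarrow> 0"
    and frequency: "\<And>h. (\<lambda>n. (\<Sum>k<n. touches h (t k) - (\<Sum>e\<in>E. touches h e) / real (card E)) / real n)
      \<longlonglongrightarrow> 0"
  shows "(\<lambda>k. local_avg \<gamma> b t k) \<longlonglongrightarrow> x_loc E b"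
proof (rule vec_tendstoI)
  fix h
  let ?m = "real (card E)"
  note avg = average_err_tendsto_0[OF t sublinear increment, of h]
  define d where "d = (\<Sum>e\<in>E. touches h e)"
  have d: "d / ?m > 0"
    using sum_touches_pos[OF connected two_nodes] card_E_pos by (simp add: d_def)
  let ?Z = "\<lambda>n. \<Sum>k<n. touches h (t k) * err (Suc k) t $ h"
  let ?\<kappa> = "\<lambda>n. real (updates t n h)"
  have Z: "(\<lambda>n. ?Z n / real n) \<longlonglongrightarrow> 0"
  proof -
    let ?I = "\<lambda>n. \<Sum>k<n. touches h (t k) * err_step (err k t) (t k) $ h
      - (d * err k t $ h - \<gamma> * laplacian E (err k t) $ h) / ?m"
    \<comment> \<open>Adding back the centring terms expresses \<open>?Z\<close> through sums whose
      time averages all vanish in the limit.\<close>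
    have "?Z n = ?I n + d / ?m * (\<Sum>k<n. err k t $ h) - \<gamma> / ?m * (\<Sum>k<n. laplacian E (err k t) $ h)"
      for n
      by (simp add: err_Suc t sum.distrib sum_subtractf sum_distrib_left diff_divide_distrib)
    then have eq: "?Z n / real n = ?I n / real n + d / ?m * ((\<Sum>k<n. err k t $ h) / real n)
        - \<gamma> / ?m * ((\<Sum>k<n. laplacian E (err k t) $ h) / real n)" for n
      by (simp add: add_divide_distrib diff_divide_distrib)
    have "(\<lambda>n. ?I n / real n + d / ?m * ((\<Sum>k<n. err k t $ h) / real n)
        - \<gamma> / ?m * ((\<Sum>k<n. laplacian E (err k t) $ h) / real n)) \<longlonglongrightarrow> 0 + d / ?m * 0 - \<gamma> / ?m * 0"
      by (intro tendsto_intros touched[of h, folded d_def] avg)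
    then show ?thesis unfolding eq by simp
  qed
  have \<kappa>: "(\<lambda>n. ?\<kappa> n / real n) \<longlonglongrightarrow> d / ?m"
  proof -
    have "(\<lambda>n. (\<Sum>k<n. touches h (t k) - d / ?m) / real n + d / ?m) \<longlonglongrightarrow> 0 + d / ?m"
      by (intro tendsto_intros frequency[of h, folded d_def])
    moreover have "\<forall>\<^sub>F n in sequentially.
        (\<Sum>k<n. touches h (t k) - d / ?m) / real n + d / ?m = ?\<kappa> n / real n"
      using eventually_gt_at_top[of 0]
      by eventually_elim (simp add: updates_eq sum_subtractf diff_divide_distrib)
    ultimately show ?thesis by (simp add: filterlim_cong[OF refl refl])
  qed
  have "(\<lambda>n. (?Z n / real n) / (?\<kappa> n / real n) + x_loc E b $ h) \<longlonglongrightarrow> 0 / (d / ?m) + x_loc E b $ h"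
    by (rule tendsto_add[OF tendsto_divide[OF Z \<kappa>] tendsto_const]) (metis d less_irrefl)
  moreover have "\<forall>\<^sub>F n in sequentially.
      (?Z n / real n) / (?\<kappa> n / real n) + x_loc E b $ h = local_avg \<gamma> b t n $ h"
    \<comment> \<open>A positive limiting frequency makes the counter eventually positive, so that
      it can be divided out; n > 0 allows the common factor n to be cancelled.\<close>
    using order_tendstoD(1)[OF \<kappa> d] eventually_gt_at_top[of 0]
  proof eventually_elim
    case (elim n)
    then have pos: "?\<kappa> n > 0" by (simp add: zero_less_divide_iff)
    have "?Z n = (\<Sum>k<n. touches h (t k) * gossip \<gamma> b t (Suc k) $ h) - ?\<kappa> n * x_loc E b $ h"
      by (simp add: err_def updates_eq sum_distrib_right sum_subtractf right_diff_distrib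
          del: gossip.simps)
    then have "?\<kappa> n * local_avg \<gamma> b t n $ h = ?Z n + ?\<kappa> n * x_loc E b $ h"
      by (simp only: updates_times_local_avg)
    then have "local_avg \<gamma> b t n $ h = ?Z n / ?\<kappa> n + x_loc E b $ h"
      using pos by (simp add: field_simps)
    then show ?case using elim by simp
  qed
  ultimately show "(\<lambda>n. local_avg \<gamma> b t n $ h) \<longlonglongrightarrow> x_loc E b $ h"
    by (simp add: filterlim_cong[OF refl refl])
qed

lemma AE_local_avg_tendsto: "AE \<omega> in M. (\<lambda>k. local_avg \<gamma> b (path \<omega>) k) \<longlonglongrightarrow> x_loc E b"
proof -
  from AE_space AE_err_sublinear AE_average_increment AE_average_touched AE_average_touches
  show ?thesis
  proof eventually_elim
    case (elim \<omega>)
    show ?case by (rule local_avg_tendsto) (use elim path_in in blast)+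
  qed
qed

end

theorem theorem2:
  fixes E :: "('v::{finite,linorder} \<times> 'v) set"
    and b :: "'v \<times> 'v \<Rightarrow> real"
    and \<gamma> :: real
    and M :: "'w measure"
    and \<theta> :: "nat \<Rightarrow> 'w \<Rightarrow> 'v \<times> 'v"
  assumes "oriented_graph E"
    and "weakly_connected E"
    and "CARD('v) > 2"
    and "0 < \<gamma>" and "\<gamma> < 1"
    and "prob_space M"
    and "prob_space.indep_vars M (\<lambda>_. count_space E) \<theta> UNIV"
    and "\<And>k e. e \<in> E \<Longrightarrow> measure M {\<omega> \<in> space M. \<theta> k \<omega> = e} = 1 / real (card E)"
  shows "(\<forall>z. is_arg_min norm (least_squares_solution (incidence E) (edge_vec E b)) z
              \<longleftrightarrow> z = x_loc E b)
       \<and> (AE \<omega> in M. (\<lambda>k. local_avg \<gamma> b (\<lambda>n. \<theta> n \<omega>) k) \<longlonglongrightarrow> x_loc E b)"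
proof -
  interpret prob_space M by (rule assms(6))
  interpret randomized_gossip M E \<theta> b \<gamma>
    by unfold_locales (use assms in auto)
  show ?thesis
    using x_loc_min_norm[OF assms(1,2)] AE_local_avg_tendsto by blast
qed

end
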